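(* Suppose that $\hat{\Sigma}_x[i,j]\neq0$ for all $i,j\in\{0,\ldots,L-1\}$. Then a matrix $X\in\mathbb{C}^{L\times L}$ satisfies the set of equations $P_y=\mathcal{P}(X)$, $T_y=\mathcal{T}(X)$ if and only if $$X=\hat{\Sigma}_x\odot\operatorname{Circulant}\left\{[1,e^{\imath\varphi_1},\ldots,e^{\imath\varphi_{L-1}}]\right\}$$ for some (otherwise arbitrary) $\varphi_1,\ldots,\varphi_{L-1}\in[0,2\pi)$.
   Context: All indices are in $\{0,\ldots,L-1\}$ and are taken modulo $L$. $\overline{(\cdot)}$ is complex conjugation, $(\cdot)^*$ is conjugate transpose, $\odot$ is the entrywise (Hadamard) product, and $\operatorname{Circulant}\{z\}[k_1,k_2]=z[\operatorname{mod}(k_2-k_1,L)]$ for $z\in\mathbb{C}^L$. Model (complex-valued, noiseless). $x=\sum_{i=1}^r a_i v_i\in\mathbb{C}^L$, where $v_1,\ldots,v_r\in\mathbb{C}^L$ are orthonormal, $a_1,\ldots,a_r$ are independent, $a_i\sim\mathbb{C}\mathcal{N}(0,\lambda_i)$ (circularly-symmetric complex normal with variance $\lambda_i>0$). The observation is $y=R_s\{x\}$, where $R_s\{x\}[\ell]=x[\ell-s]$ is the cyclic shift and $s$ is a random element of $\mathbb{Z}_L$ with an arbitrary distribution, independent of $x$. Let $F[\ell,k]=\frac{1}{\sqrt{L}}e^{-\imath 2\pi k\ell/L}$ be the unitary DFT matrix, $\hat{x}=Fx$, $\hat{y}=Fy$, and $\hat{\Sigma}_x=\mathbb{E}[\hat{x}\hat{x}^*]$.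 Power spectrum and trispectrum: $P_y[k]=\mathbb{E}\big[\hat{y}[k]\overline{\hat{y}[k]}\big]$ and $T_y[k_1,k_2,k_3]=\mathbb{E}\big[\hat{y}[k_1]\overline{\hat{y}[k_2]}\hat{y}[k_3]\overline{\hat{y}[k_1-k_2+k_3]}\big]$. Maps on $X\in\mathbb{C}^{L\times L}$: $\mathcal{P}(X)[k_1]=X[k_1,k_1]$ and $\mathcal{T}(X)[k_1,k_2,k_3]=X[k_1,k_2]\,\overline{X[k_3-k_2+k_1,k_3]}+X[k_1,k_3-k_2+k_1]\,\overline{X[k_2,k_3]}$. *)

theory Defs
  imports "HOL-Probability.Probability" "Jordan_Normal_Form.Matrix"
begin

text \<open>
  Vectors and matrices are those of \<^theory>\<open>Jordan_Normal_Form.Matrix\<close>, indexed by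
  \<open>0, \<dots>, L - 1\<close>. The competing \<^term>\<open>CARD('n)\<close>-indexed type and notation of HOL-Analysis are hidden.
\<close>

unbundle no vec_syntax
hide_type (open) Finite_Cartesian_Product.vec
hide_const (open) Finite_Cartesian_Product.vec Finite_Cartesian_Product.mat

text \<open>Index arithmetic modulo \<open>L\<close> is carried out on \<^typ>\<open>int\<close>, to avoid truncated subtraction.\<close>

definition cyc :: "nat \<Rightarrow> int \<Rightarrow> nat" where
  "cyc L k = nat (k mod int L)"

definition cyclic_shift :: "nat \<Rightarrow> nat \<Rightarrow> complex vec \<Rightarrow> complex vec" where
  "cyclic_shift L s u = vec L (\<lambda>l. u $ cyc L (int l - int s))"

definition dft_mat :: "nat \<Rightarrow> complex mat" where
  "dft_mat L = mat L L (\<lambda>(l, k).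
     1 / complex_of_real (sqrt (real L)) * exp (- (\<i> * 2 * complex_of_real pi * of_nat k * of_nat l / of_nat L)))"

definition circulant :: "complex vec \<Rightarrow> complex mat" where
  "circulant z = mat (dim_vec z) (dim_vec z) (\<lambda>(k1, k2). z $ cyc (dim_vec z) (int k2 - int k1))"

definition hadamard :: "complex mat \<Rightarrow> complex mat \<Rightarrow> complex mat" where
  "hadamard A B = mat (dim_row A) (dim_col A) (\<lambda>ij. A $$ ij * B $$ ij)"

definition orthonormal_family :: "nat \<Rightarrow> 'i set \<Rightarrow> ('i \<Rightarrow> complex vec) \<Rightarrow> bool" where
  "orthonormal_family L I v \<longleftrightarrow>
     (\<forall>i\<in>I. v i \<in> carrier_vec L) \<and>
     (\<forall>i\<in>I. \<forall>j\<in>I. v i \<bullet>c v j = (if i = j then 1 else 0))"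

text \<open>
  Circularly-symmetric complex normal of variance \<open>\<sigma>2 = E |Z|\<^sup>2\<close>: the real and imaginary
  parts are independent and each carries half of the variance.
\<close>

definition complex_normal :: "'w measure \<Rightarrow> real \<Rightarrow> ('w \<Rightarrow> complex) \<Rightarrow> bool" where
  "complex_normal M \<sigma>2 Z \<longleftrightarrow>
     prob_space.indep_var M borel (\<lambda>\<omega>. Re (Z \<omega>)) borel (\<lambda>\<omega>. Im (Z \<omega>)) \<and>
     distributed M lborel (\<lambda>\<omega>. Re (Z \<omega>)) (normal_density 0 (sqrt (\<sigma>2 / 2))) \<and>
     distributed M lborel (\<lambda>\<omega>. Im (Z \<omega>)) (normal_density 0 (sqrt (\<sigma>2 / 2)))"

text \<open>
  Independence of two random variables whose value types may differ, which
  \<^const>\<open>prob_space.indep_var\<close> does not allow.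
\<close>

definition indep_rv :: "'w measure \<Rightarrow> 'b measure \<Rightarrow> ('w \<Rightarrow> 'b) \<Rightarrow> 'c measure \<Rightarrow> ('w \<Rightarrow> 'c) \<Rightarrow> bool" where
  "indep_rv M N X K Y \<longleftrightarrow>
     X \<in> measurable M N \<and> Y \<in> measurable M K \<and>
     prob_space.indep_set M {X -` A \<inter> space M |A. A \<in> sets N} {Y -` B \<inter> space M |B. B \<in> sets K}"

text \<open>
  \<^typ>\<open>complex vec\<close> carries no measure structure in the library, so a random vector of
  dimension \<open>L\<close> is measured through its family of components.
\<close>

definition vec_fun :: "nat \<Rightarrow> complex vec \<Rightarrow> nat \<Rightarrow> complex" where
  "vec_fun L u = (\<lambda>l\<in>{..<L}. u $ l)"

abbreviation vec_borel :: "nat \<Rightarrow> (nat \<Rightarrow> complex) measure" where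
  "vec_borel L \<equiv> PiM {..<L} (\<lambda>_. borel)"

text \<open>The entrywise expectation of \<open>z z\<^sup>*\<close>.\<close>

definition second_moment :: "'w measure \<Rightarrow> nat \<Rightarrow> ('w \<Rightarrow> complex vec) \<Rightarrow> complex mat" where
  "second_moment M L z = mat L L (\<lambda>(i, j). LINT \<omega>|M. z \<omega> $ i * cnj (z \<omega> $ j))"

definition power_spectrum :: "'w measure \<Rightarrow> nat \<Rightarrow> ('w \<Rightarrow> complex vec) \<Rightarrow> nat \<Rightarrow> complex" where
  "power_spectrum M L y k =
     (LINT \<omega>|M. (dft_mat L *\<^sub>v y \<omega>) $ k * cnj ((dft_mat L *\<^sub>v y \<omega>) $ k))"

definition trispectrum ::
  "'w measure \<Rightarrow> nat \<Rightarrow> ('w \<Rightarrow> complex vec) \<Rightarrow> nat \<Rightarrow> nat \<Rightarrow> nat \<Rightarrow> complex" where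
  "trispectrum M L y k1 k2 k3 =
     (LINT \<omega>|M. (dft_mat L *\<^sub>v y \<omega>) $ k1 * cnj ((dft_mat L *\<^sub>v y \<omega>) $ k2) *
        (dft_mat L *\<^sub>v y \<omega>) $ k3 *
        cnj ((dft_mat L *\<^sub>v y \<omega>) $ cyc L (int k1 - int k2 + int k3)))"

definition P_map :: "complex mat \<Rightarrow> nat \<Rightarrow> complex" where
  "P_map X k1 = X $$ (k1, k1)"

definition T_map :: "nat \<Rightarrow> complex mat \<Rightarrow> nat \<Rightarrow> nat \<Rightarrow> nat \<Rightarrow> complex" where
  "T_map L X k1 k2 k3 =
     X $$ (k1, k2) * cnj (X $$ (cyc L (int k3 - int k2 + int k1), k3)) +
     X $$ (k1, cyc L (int k3 - int k2 + int k1)) * cnj (X $$ (k2, k3))"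

end

theory Submission
  imports Defs
begin

text \<open>
  A shift multiplies \<open>dft_mat L *\<^sub>v x\<close> by phases that cancel pointwise in both spectra, so \<open>y\<close> may be
  replaced by \<open>x\<close>, and Isserlis' formula for circular Gaussians identifies the spectra of \<open>x\<close> with
  \<open>P_map \<Sigma>\<close> and \<open>T_map L \<Sigma>\<close>. For the algebraic part, let \<open>q d k = X[k, k + d] / \<Sigma>[k, k + d]\<close> and read the
  trispectrum equation at \<open>(k, k + d, k + d + e)\<close>. For \<open>e = 0\<close>, the diagonal being known, it gives
  \<open>\<bar>q d k\<bar> = 1\<close>; for \<open>d = e = 1\<close> it shows that \<open>q 1\<close> is constant; and then for \<open>e = 1\<close> the terms in
  \<open>q 1\<close> drop out and every \<open>q d\<close> is constant, which is the circulant structure.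
\<close>

section \<open>Moments of real and complex Gaussian variables\<close>

text \<open>For even \<open>n\<close> this is \<open>\<sigma> ^ n\<close> times the double factorial
  of \<open>n - 1\<close>, in the shape of the library fact
  \<open>normal_moment_even\<close>.\<close>

definition normal_moment :: "real \<Rightarrow> nat \<Rightarrow> real" where
  "normal_moment \<sigma> n = (if even n then fact n / ((2 / \<sigma>\<^sup>2) ^ (n div 2) * fact (n div 2)) else 0)"

lemma distributed_normal_power:
  assumes "distributed M lborel X (normal_density 0 \<sigma>)" and "\<sigma> > 0"
  shows "has_bochner_integral M (\<lambda>\<omega>. X \<omega> ^ n) (normal_moment \<sigma> n)"
proof -
  have "has_bochner_integral lborel (\<lambda>x. normal_density 0 \<sigma> x * x ^ n) (normal_moment \<sigma> n)"
  proof (cases "even n")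
    case True
    then show ?thesis
      using normal_moment_even[OF \<open>\<sigma> > 0\<close>, of 0 "n div 2"] by (simp add: normal_moment_def)
  next
    case False
    then show ?thesis
      using normal_moment_odd[OF \<open>\<sigma> > 0\<close>, of 0 "n div 2"] by (simp add: normal_moment_def)
  qed
  then show ?thesis
    using distributed_integrable[OF assms(1), of "\<lambda>x. x ^ n"]
      distributed_integral[OF assms(1), of "\<lambda>x. x ^ n"]
    by (simp add: has_bochner_integral_iff)
qed

text \<open>Independence of real and imaginary part passes to their powers and splits the
  expectation. The cast to complex values matches the terms of a complex binomial expansion.\<close>

lemma complex_normal_Re_Im_power:
  assumes "prob_space M" and "complex_normal M \<sigma>2 Z" and "\<sigma>2 > 0"
  shows "has_bochner_integral M (\<lambda>\<omega>. complex_of_real (Re (Z \<omega>) ^ m * Im (Z \<omega>) ^ n))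
           (complex_of_real (normal_moment (sqrt (\<sigma>2 / 2)) m * normal_moment (sqrt (\<sigma>2 / 2)) n))"
proof -
  interpret prob_space M by fact
  have pos: "sqrt (\<sigma>2 / 2) > 0"
    using assms(3) by simp
  have ind: "indep_var borel (\<lambda>\<omega>. Re (Z \<omega>)) borel (\<lambda>\<omega>. Im (Z \<omega>))"
    and R: "has_bochner_integral M (\<lambda>\<omega>. Re (Z \<omega>) ^ m) (normal_moment (sqrt (\<sigma>2 / 2)) m)"
    and I: "has_bochner_integral M (\<lambda>\<omega>. Im (Z \<omega>) ^ n) (normal_moment (sqrt (\<sigma>2 / 2)) n)"
    using assms(2) pos by (auto simp: complex_normal_def intro: distributed_normal_power)
  have "indep_var borel (\<lambda>\<omega>. Re (Z \<omega>) ^ m) borel (\<lambda>\<omega>. Im (Z \<omega>) ^ n)"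
    using indep_var_compose[OF ind, of "\<lambda>t. t ^ m" borel "\<lambda>t. t ^ n" borel] by (simp add: comp_def)
  then have "has_bochner_integral M (\<lambda>\<omega>. Re (Z \<omega>) ^ m * Im (Z \<omega>) ^ n)
      (normal_moment (sqrt (\<sigma>2 / 2)) m * normal_moment (sqrt (\<sigma>2 / 2)) n)"
    using R I indep_var_lebesgue_integral indep_var_integrable
    by (auto simp: has_bochner_integral_iff)
  then show ?thesis
    by (rule has_bochner_integral_of_real)
qed

text \<open>Both powers are expanded binomially in real and imaginary part. Exponents up to 2 leave
  nine cases and cover a product of two plain and two conjugated factors. The zero for unequal
  exponents expresses circularity.\<close>

lemma complex_normal_moment:
  assumes "prob_space M" and "complex_normal M \<sigma>2 Z" and "\<sigma>2 > 0" and "p \<le> 2" and "q \<le> 2"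
  shows "has_bochner_integral M (\<lambda>\<omega>. Z \<omega> ^ p * cnj (Z \<omega>) ^ q)
           (if p = q then fact p * complex_of_real \<sigma>2 ^ p else 0)"
proof -
  define c where "c i j = of_nat (p choose i) * of_nat (q choose j) * \<i> ^ (p - i) * (- \<i>) ^ (q - j)"
    for i j
  have expand: "Z \<omega> ^ p * cnj (Z \<omega>) ^ q =
      (\<Sum>i\<le>p. \<Sum>j\<le>q. c i j *
        complex_of_real (Re (Z \<omega>) ^ (i + j) * Im (Z \<omega>) ^ (p - i + (q - j))))" for \<omega>
  proof -
    have "Z \<omega> ^ p * cnj (Z \<omega>) ^ q =
        (of_real (Re (Z \<omega>)) + \<i> * of_real (Im (Z \<omega>))) ^ p *
        (of_real (Re (Z \<omega>)) + (- \<i>) * of_real (Im (Z \<omega>))) ^ q"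
      by (metis complex_cnj_add complex_cnj_complex_of_real complex_cnj_i complex_cnj_mult complex_eq)
    also have "\<dots> = (\<Sum>i\<le>p. \<Sum>j\<le>q. c i j *
        complex_of_real (Re (Z \<omega>) ^ (i + j) * Im (Z \<omega>) ^ (p - i + (q - j))))"
      unfolding binomial_ring sum_product c_def
      by (simp only: power_mult_distrib power_add of_real_mult of_real_power mult_ac)
    finally show ?thesis .
  qed
  have "has_bochner_integral M (\<lambda>\<omega>. Z \<omega> ^ p * cnj (Z \<omega>) ^ q)
      (\<Sum>i\<le>p. \<Sum>j\<le>q. c i j * complex_of_real
        (normal_moment (sqrt (\<sigma>2 / 2)) (i + j) * normal_moment (sqrt (\<sigma>2 / 2)) (p - i + (q - j))))"
    unfolding expand
    by (intro has_bochner_integral_sum has_bochner_integral_mult_right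
        complex_normal_Re_Im_power assms)
  moreover have "(\<Sum>i\<le>p. \<Sum>j\<le>q. c i j * complex_of_real
        (normal_moment (sqrt (\<sigma>2 / 2)) (i + j) * normal_moment (sqrt (\<sigma>2 / 2)) (p - i + (q - j)))) =
      (if p = q then fact p * complex_of_real \<sigma>2 ^ p else 0)"
  proof -
    \<comment> \<open>As \<open>p + q \<le> 4\<close>, only real moments of order at most 4
      occur.\<close>
    have mom: "normal_moment (sqrt (\<sigma>2 / 2)) 0 = 1" "normal_moment (sqrt (\<sigma>2 / 2)) (Suc 0) = 0"
      "normal_moment (sqrt (\<sigma>2 / 2)) 2 = \<sigma>2 / 2" "normal_moment (sqrt (\<sigma>2 / 2)) 3 = 0"
      "normal_moment (sqrt (\<sigma>2 / 2)) 4 = 3 * (\<sigma>2 / 2)\<^sup>2"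
      using assms(3)
      by (simp_all add: normal_moment_def fact_numeral power_divide field_simps power2_eq_square)
    have atMost: "{..0 :: nat} = {0}" "{..Suc 0} = {0, 1}" "{..2 :: nat} = {0, 1, 2}"
      by auto
    have "p \<in> {0, 1, 2}" "q \<in> {0, 1, 2}"
      using assms(4,5) by auto
    then show ?thesis
      by (auto simp: c_def atMost mom mom(3)[unfolded numeral_2_eq_2]
          mom(4)[unfolded numeral_3_eq_3] power2_eq_square)
  qed
  ultimately show ?thesis
    by simp
qed

text \<open>The exponent acts as a Kronecker delta: a single variable becomes a monomial over all of
  \<open>I\<close>, to which the product rule for independent families applies.\<close>

lemma prod_power_of_bool_eq:
  fixes f :: "'i \<Rightarrow> 'c :: comm_semiring_1"
  assumes "finite I" and "i \<in> I"
  shows "(\<Prod>m\<in>I. f m ^ of_bool (m = i)) = f i"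
proof -
  have "(\<Prod>m\<in>I. f m ^ of_bool (m = i)) = (\<Prod>m\<in>I. if m = i then f m else 1)"
    by (intro prod.cong) auto
  then show ?thesis
    using assms by simp
qed

lemma sum_mult_of_bool_eq2:
  fixes f :: "'i \<Rightarrow> 'i \<Rightarrow> 'c :: semiring_1"
  assumes "finite I" and "m \<in> I" and "n \<in> I"
  shows "(\<Sum>j\<in>I. \<Sum>l\<in>I. f j l * (of_bool (j = m) * of_bool (l = n))) = f m n"
proof -
  have "(\<Sum>j\<in>I. \<Sum>l\<in>I. f j l * (of_bool (j = m) * of_bool (l = n))) =
      (\<Sum>j\<in>I. if j = m then (\<Sum>l\<in>I. if l = n then f m n else 0) else 0)"
    by (intro sum.cong refl) (auto intro!: sum.cong sum.neutral)
  then show ?thesis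
    using assms by simp
qed

section \<open>Joint moments of independent circular Gaussians and Isserlis' formula\<close>

context
  fixes M :: "'w measure" and I :: "'i set" and a :: "'i \<Rightarrow> 'w \<Rightarrow> complex" and lam :: "'i \<Rightarrow> real"
  assumes M: "prob_space M" and fin: "finite I"
    and pos: "\<And>i. i \<in> I \<Longrightarrow> lam i > 0"
    and normal: "\<And>i. i \<in> I \<Longrightarrow> complex_normal M (lam i) (a i)"
    and indep: "prob_space.indep_vars M (\<lambda>_. borel) a I"
begin

interpretation prob_space M by (rule M)

text \<open>Independence reduces the monomial to one-variable moments, and one index with
  \<open>p m \<noteq> q m\<close> makes the whole product vanish.\<close>

lemma indep_complex_normal_moment:
  assumes "\<And>m. m \<in> I \<Longrightarrow> p m \<le> 2" and "\<And>m. m \<in> I \<Longrightarrow> q m \<le> 2"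
  shows "has_bochner_integral M (\<lambda>\<omega>. \<Prod>m\<in>I. a m \<omega> ^ p m * cnj (a m \<omega>) ^ q m)
           (\<Prod>m\<in>I. if p m = q m then fact (p m) * complex_of_real (lam m) ^ p m else 0)"
proof -
  have ind: "indep_vars (\<lambda>_. borel) (\<lambda>m \<omega>. a m \<omega> ^ p m * cnj (a m \<omega>) ^ q m) I"
    by (rule indep_vars_compose2[OF indep, where Y = "\<lambda>m z. z ^ p m * cnj z ^ q m"])
      (intro borel_measurable_continuous_onI continuous_intros)
  have mom: "has_bochner_integral M (\<lambda>\<omega>. a m \<omega> ^ p m * cnj (a m \<omega>) ^ q m)
      (if p m = q m then fact (p m) * complex_of_real (lam m) ^ p m else 0)" if "m \<in> I" for m
    using that by (intro complex_normal_moment M normal pos assms)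
  show ?thesis
    using indep_vars_lebesgue_integral[OF fin ind] indep_vars_integrable[OF fin ind] mom
    by (auto simp: has_bochner_integral_iff intro!: prod.cong)
qed

text \<open>A monomial with indicator exponents; for distinct indices the factor at \<open>i\<close>
  has exponents 1 and 0, hence mean zero.\<close>

lemma indep_complex_normal_moment2:
  assumes "i \<in> I" and "j \<in> I"
  shows "has_bochner_integral M (\<lambda>\<omega>. a i \<omega> * cnj (a j \<omega>))
           (complex_of_real (lam i) * of_bool (i = j))"
proof -
  define p q :: "'i \<Rightarrow> nat" where "p m = of_bool (m = i)" and "q m = of_bool (m = j)" for m
  have "(\<Prod>m\<in>I. if p m = q m then fact (p m) * complex_of_real (lam m) ^ p m else 0) =
      complex_of_real (lam i) * of_bool (i = j)"
  proof (cases "i = j")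
    case True
    then have "(\<Prod>m\<in>I. if p m = q m then fact (p m) * complex_of_real (lam m) ^ p m else 0) =
        (\<Prod>m\<in>I. complex_of_real (lam m) ^ p m)"
      by (intro prod.cong) (auto simp: p_def q_def)
    with True show ?thesis
      using assms fin by (simp add: p_def prod_power_of_bool_eq)
  next
    case False
    then show ?thesis
      using assms fin by (auto intro!: prod_zero bexI[of _ i] simp: p_def q_def)
  qed
  moreover have "(\<Prod>m\<in>I. a m \<omega> ^ p m * cnj (a m \<omega>) ^ q m) = a i \<omega> * cnj (a j \<omega>)" for \<omega>
    using assms fin by (simp add: p_def q_def prod.distrib prod_power_of_bool_eq)
  ultimately show ?thesis
    using indep_complex_normal_moment[of p q] by (simp add: p_def q_def)
qed

text \<open>\<open>p\<close> counts occurrences among the plain indices \<open>i\<close>,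
  \<open>k\<close>, and \<open>q\<close> among the conjugated ones \<open>j\<close>,
  \<open>l\<close>; the moment survives exactly when the two multisets agree. If also
  \<open>i = k\<close>, both pairings hold at once, which accounts for the factor
  \<open>fact 2\<close>.\<close>

lemma indep_complex_normal_moment4:
  assumes "i \<in> I" and "j \<in> I" and "k \<in> I" and "l \<in> I"
  shows "has_bochner_integral M (\<lambda>\<omega>. a i \<omega> * cnj (a j \<omega>) * a k \<omega> * cnj (a l \<omega>))
           (complex_of_real (lam i) * complex_of_real (lam k) *
             (of_bool (i = j) * of_bool (k = l) + of_bool (i = l) * of_bool (k = j)))"
proof -
  define p q :: "'i \<Rightarrow> nat"
    where "p m = of_bool (m = i) + of_bool (m = k)" and "q m = of_bool (m = j) + of_bool (m = l)" for m
  let ?E = "\<lambda>m. if p m = q m then fact (p m) * complex_of_real (lam m) ^ p m else 0"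
  have "prod ?E I = complex_of_real (lam i) * complex_of_real (lam k) *
      (of_bool (i = j) * of_bool (k = l) + of_bool (i = l) * of_bool (k = j))"
  proof (cases "i = j \<and> k = l \<or> i = l \<and> k = j")
    case True
    \<comment> \<open>The extra weight is \<open>fact (p m)\<close>, which is 2 only at
      \<open>m = i = k\<close>.\<close>
    then have "prod ?E I = (\<Prod>m\<in>I. (if m = i then if i = k then 2 else 1 else 1) *
        (complex_of_real (lam m) ^ of_bool (m = i) * complex_of_real (lam m) ^ of_bool (m = k)))"
      by (intro prod.cong) (auto simp: p_def q_def power2_eq_square)
    also have "\<dots> = (if i = k then 2 else 1) * (complex_of_real (lam i) * complex_of_real (lam k))"
      using assms fin by (simp add: prod.distrib prod_power_of_bool_eq)
    finally show ?thesis
      using True by auto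
  next
    case False
    \<comment> \<open>\<open>p\<close> and \<open>q\<close> both have total 2 and \<open>p\<close>
      sits on \<open>i\<close> and \<open>k\<close>, so agreement there would force the multisets to
      agree.\<close>
    then have "p i \<noteq> q i \<or> p k \<noteq> q k"
      by (auto simp: p_def q_def of_bool_def split: if_splits)
    then have "prod ?E I = 0"
      using assms fin by (auto intro!: prod_zero)
    then show ?thesis
      using False by auto
  qed
  moreover have "(\<Prod>m\<in>I. a m \<omega> ^ p m * cnj (a m \<omega>) ^ q m) =
      a i \<omega> * cnj (a j \<omega>) * a k \<omega> * cnj (a l \<omega>)" for \<omega>
    using assms fin by (simp add: p_def q_def power_add prod.distrib prod_power_of_bool_eq)
  ultimately show ?thesis
    using indep_complex_normal_moment[of p q] by (simp add: p_def q_def)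
qed

lemma complex_normal_combination_moment2:
  "has_bochner_integral M
     (\<lambda>\<omega>. (\<Sum>i\<in>I. a i \<omega> * \<alpha> i) * cnj (\<Sum>i\<in>I. a i \<omega> * \<beta> i))
     (\<Sum>i\<in>I. complex_of_real (lam i) * \<alpha> i * cnj (\<beta> i))"
proof -
  have "has_bochner_integral M
     (\<lambda>\<omega>. \<Sum>i\<in>I. \<Sum>j\<in>I. (\<alpha> i * cnj (\<beta> j)) * (a i \<omega> * cnj (a j \<omega>)))
     (\<Sum>i\<in>I. \<Sum>j\<in>I. (\<alpha> i * cnj (\<beta> j)) * (complex_of_real (lam i) * of_bool (i = j)))"
    by (intro has_bochner_integral_sum has_bochner_integral_mult_right indep_complex_normal_moment2)
  then show ?thesis
    using fin by (simp add: sum_product mult_ac of_bool_def if_distrib[of "(*) _"] cong: if_cong)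
qed

text \<open>Isserlis' formula for circular variables: each plain factor is paired with a conjugated
  one, in two ways, and each sum in the result is a second moment as in
  \<open>complex_normal_combination_moment2\<close>.\<close>

lemma complex_normal_combination_moment4:
  "has_bochner_integral M
     (\<lambda>\<omega>. (\<Sum>i\<in>I. a i \<omega> * \<alpha> i) * cnj (\<Sum>i\<in>I. a i \<omega> * \<beta> i) *
          (\<Sum>i\<in>I. a i \<omega> * \<gamma> i) * cnj (\<Sum>i\<in>I. a i \<omega> * \<delta> i))
     ((\<Sum>i\<in>I. complex_of_real (lam i) * \<alpha> i * cnj (\<beta> i)) *
        (\<Sum>i\<in>I. complex_of_real (lam i) * \<gamma> i * cnj (\<delta> i)) +
      (\<Sum>i\<in>I. complex_of_real (lam i) * \<alpha> i * cnj (\<delta> i)) *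
        (\<Sum>i\<in>I. complex_of_real (lam i) * \<gamma> i * cnj (\<beta> i)))"
proof -
  let ?c = "\<lambda>i j k l. \<alpha> i * cnj (\<beta> j) * \<gamma> k * cnj (\<delta> l)"
  \<comment> \<open>The plain indices \<open>i\<close>, \<open>k\<close> are summed outside, so that
    the deltas remove the inner sums over \<open>j\<close>, \<open>l\<close>.\<close>
  have "has_bochner_integral M
     (\<lambda>\<omega>. \<Sum>i\<in>I. \<Sum>k\<in>I. \<Sum>j\<in>I. \<Sum>l\<in>I. ?c i j k l * (a i \<omega> * cnj (a j \<omega>) * a k \<omega> * cnj (a l \<omega>)))
     (\<Sum>i\<in>I. \<Sum>k\<in>I. \<Sum>j\<in>I. \<Sum>l\<in>I. ?c i j k l * (complex_of_real (lam i) * complex_of_real (lam k) *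
        (of_bool (i = j) * of_bool (k = l) + of_bool (i = l) * of_bool (k = j))))"
    by (intro has_bochner_integral_sum has_bochner_integral_mult_right indep_complex_normal_moment4)
  moreover have "(\<Sum>i\<in>I. \<Sum>k\<in>I. \<Sum>j\<in>I. \<Sum>l\<in>I. ?c i j k l * (a i \<omega> * cnj (a j \<omega>) * a k \<omega> * cnj (a l \<omega>))) =
      (\<Sum>i\<in>I. a i \<omega> * \<alpha> i) * cnj (\<Sum>i\<in>I. a i \<omega> * \<beta> i) *
      (\<Sum>i\<in>I. a i \<omega> * \<gamma> i) * cnj (\<Sum>i\<in>I. a i \<omega> * \<delta> i)" for \<omega>
  proof -
    have "(\<Sum>i\<in>I. a i \<omega> * \<alpha> i) * cnj (\<Sum>i\<in>I. a i \<omega> * \<beta> i) *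
        (\<Sum>i\<in>I. a i \<omega> * \<gamma> i) * cnj (\<Sum>i\<in>I. a i \<omega> * \<delta> i) =
        ((\<Sum>i\<in>I. a i \<omega> * \<alpha> i) * (\<Sum>i\<in>I. a i \<omega> * \<gamma> i)) *
        ((\<Sum>i\<in>I. cnj (a i \<omega> * \<beta> i)) * (\<Sum>i\<in>I. cnj (a i \<omega> * \<delta> i)))"
      by (simp add: mult_ac)
    also have "\<dots> = (\<Sum>i\<in>I. \<Sum>k\<in>I. \<Sum>j\<in>I. \<Sum>l\<in>I.
        ?c i j k l * (a i \<omega> * cnj (a j \<omega>) * a k \<omega> * cnj (a l \<omega>)))"
      by (simp only: sum_product) (simp add: sum_distrib_left sum_distrib_right mult_ac,
          rule sum.cong[OF refl], rule sum.swap)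
    finally show ?thesis ..
  qed
  moreover have "(\<Sum>j\<in>I. \<Sum>l\<in>I. ?c i j k l * (complex_of_real (lam i) * complex_of_real (lam k) *
        (of_bool (i = j) * of_bool (k = l) + of_bool (i = l) * of_bool (k = j)))) =
      (complex_of_real (lam i) * \<alpha> i * cnj (\<beta> i)) * (complex_of_real (lam k) * \<gamma> k * cnj (\<delta> k)) +
      (complex_of_real (lam i) * \<alpha> i * cnj (\<delta> i)) * (complex_of_real (lam k) * \<gamma> k * cnj (\<beta> k))"
    if "i \<in> I" "k \<in> I" for i k
  proof -
    have "(\<Sum>j\<in>I. \<Sum>l\<in>I. ?c i j k l * (complex_of_real (lam i) * complex_of_real (lam k) *
        (of_bool (i = j) * of_bool (k = l) + of_bool (i = l) * of_bool (k = j)))) =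
      (\<Sum>j\<in>I. \<Sum>l\<in>I. (?c i j k l * complex_of_real (lam i) * complex_of_real (lam k)) *
        (of_bool (j = i) * of_bool (l = k))) +
      (\<Sum>j\<in>I. \<Sum>l\<in>I. (?c i j k l * complex_of_real (lam i) * complex_of_real (lam k)) *
        (of_bool (j = k) * of_bool (l = i)))"
      unfolding sum.distrib[symmetric] by (intro sum.cong refl) auto
    also have "\<dots> = ?c i i k k * complex_of_real (lam i) * complex_of_real (lam k) +
        ?c i k k i * complex_of_real (lam i) * complex_of_real (lam k)"
      using fin that by (simp only: sum_mult_of_bool_eq2)
    finally show ?thesis
      by (simp add: mult_ac)
  qed
  ultimately show ?thesis
    by (simp add: sum_product sum.distrib cong: sum.cong)
qed

end

section \<open>Cyclic indices, characters and the shift theorem for the DFT\<close>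

lemma cyc_less: "L > 0 \<Longrightarrow> cyc L t < L"
  by (simp add: cyc_def nat_less_iff)

lemma cyc_of_nat: "k < L \<Longrightarrow> cyc L (int k) = k"
  by (simp add: cyc_def)

lemma int_cyc: "L > 0 \<Longrightarrow> int (cyc L t) = t mod int L"
  by (simp add: cyc_def)

text \<open>These rules flatten nested reductions, so that cyclic translations are seen to be
  inverse to each other.\<close>

lemma cyc_add_cyc:
  "L > 0 \<Longrightarrow> cyc L (int (cyc L t) + u) = cyc L (t + u)"
  "L > 0 \<Longrightarrow> cyc L (u + int (cyc L t)) = cyc L (u + t)"
  "L > 0 \<Longrightarrow> cyc L (int (cyc L t) - u) = cyc L (t - u)"
  "L > 0 \<Longrightarrow> cyc L (u - int (cyc L t)) = cyc L (u - t)"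
  by (simp_all add: int_cyc, simp_all add: cyc_def mod_simps)

text \<open>The character behind the DFT entries. With an integer argument, conjugation is negation
  and phases can be compared by congruence modulo \<open>L\<close>.\<close>

definition root_char :: "nat \<Rightarrow> int \<Rightarrow> complex" where
  "root_char L t = cis (- (2 * pi * of_int t / real L))"

lemma root_char_add: "root_char L (t + u) = root_char L t * root_char L u"
  by (simp add: root_char_def cis_mult add_divide_distrib ring_distribs)

lemma root_char_mult_self: "L > 0 \<Longrightarrow> root_char L (int L * t) = 1"
  using cis_multiple_2pi[of "- of_int t"] by (simp add: root_char_def mult.assoc)

lemma root_char_cong:
  assumes "L > 0" and "t mod int L = u mod int L"
  shows "root_char L t = root_char L u"
proof -
  have "root_char L t = root_char L (t mod int L)" for t
    using root_char_add[of L "int L * (t div int L)" "t mod int L"] assms(1)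
    by (simp add: root_char_mult_self)
  then show ?thesis
    using assms(2) by metis
qed

lemma cnj_root_char: "cnj (root_char L t) = root_char L (- t)"
  by (simp add: root_char_def cis_cnj)

lemma dft_mat_index:
  "l < L \<Longrightarrow> k < L \<Longrightarrow> dft_mat L $$ (l, k) = root_char L (int l * int k) / complex_of_real (sqrt (real L))"
  by (simp add: dft_mat_def root_char_def cis_conv_exp mult_ac)

lemma dft_mat_dim: "dim_row (dft_mat L) = L" "dim_col (dft_mat L) = L"
  by (simp_all add: dft_mat_def)

lemma dft_mat_mult_vec:
  assumes "k < L" and "dim_vec u = L"
  shows "(dft_mat L *\<^sub>v u) $ k =
    (\<Sum>l<L. root_char L (int k * int l) / complex_of_real (sqrt (real L)) * u $ l)"
  using assms by (simp add: dft_mat_dim dft_mat_index scalar_prod_def atLeast0LessThan)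

text \<open>Substituting \<open>m = l - s\<close> modulo \<open>L\<close> moves the shift into the
  character, where periodicity and additivity split off the phase.\<close>

lemma dft_cyclic_shift:
  assumes "k < L" and "dim_vec u = L"
  shows "(dft_mat L *\<^sub>v cyclic_shift L s u) $ k =
    root_char L (int k * int s) * (dft_mat L *\<^sub>v u) $ k"
proof -
  have L: "L > 0"
    using assms(1) by simp
  have "(dft_mat L *\<^sub>v cyclic_shift L s u) $ k =
      (\<Sum>l<L. root_char L (int k * int l) / complex_of_real (sqrt (real L)) * u $ cyc L (int l - int s))"
    using assms by (simp add: dft_mat_mult_vec cyclic_shift_def)
  also have "\<dots> = (\<Sum>m<L. root_char L (int k * int (cyc L (int m + int s))) /
      complex_of_real (sqrt (real L)) * u $ m)"
    using L
    by (intro sum.reindex_bij_witness[of _ "\<lambda>m. cyc L (int m + int s)" "\<lambda>l. cyc L (int l - int s)"])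
      (auto simp: cyc_add_cyc cyc_less cyc_of_nat)
  also have "\<dots> = (\<Sum>m<L. root_char L (int k * int s) *
      (root_char L (int k * int m) / complex_of_real (sqrt (real L)) * u $ m))"
  proof (intro sum.cong refl)
    fix m
    have "root_char L (int k * int (cyc L (int m + int s))) = root_char L (int k * int s + int k * int m)"
      using L by (intro root_char_cong) (simp_all add: int_cyc mod_simps algebra_simps)
    then show "root_char L (int k * int (cyc L (int m + int s))) / complex_of_real (sqrt (real L)) * u $ m =
        root_char L (int k * int s) *
        (root_char L (int k * int m) / complex_of_real (sqrt (real L)) * u $ m)"
      by (simp add: root_char_add)
  qed
  finally show ?thesis
    using assms by (simp add: dft_mat_mult_vec sum_distrib_left)
qed

text \<open>The fourth index is chosen so that the exponents add up to a multiple of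
  \<open>L\<close>.\<close>

lemma root_char_phase_cancel:
  assumes "L > 0"
  shows "root_char L (int k1 * t) * cnj (root_char L (int k2 * t)) * root_char L (int k3 * t) *
    cnj (root_char L (int (cyc L (int k1 - int k2 + int k3)) * t)) = 1"
proof -
  let ?k4 = "int (cyc L (int k1 - int k2 + int k3))"
  have "root_char L (int k1 * t + - (int k2 * t) + int k3 * t + - (?k4 * t)) = root_char L 0"
  proof (rule root_char_cong)
    have "(int k1 - int k2 + int k3 - ?k4) * t mod int L = 0"
      using assms by (simp add: int_cyc mod_simps flip: mod_mult_left_eq)
    then show "(int k1 * t + - (int k2 * t) + int k3 * t + - (?k4 * t)) mod int L = 0 mod int L"
      by (simp add: algebra_simps)
  qed fact
  moreover have "root_char L 0 = 1"
    by (simp add: root_char_def)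
  ultimately show ?thesis
    by (simp only: cnj_root_char root_char_add)
qed

section \<open>Shift invariance of both spectra\<close>

text \<open>The integrands agree for each \<open>\<omega>\<close>, since the phase caused by the
  shift has modulus 1.\<close>

lemma power_spectrum_cyclic_shift:
  assumes "\<And>\<omega>. dim_vec (x \<omega>) = L" and "k < L"
  shows "power_spectrum M L (\<lambda>\<omega>. cyclic_shift L (s \<omega>) (x \<omega>)) k = power_spectrum M L x k"
proof -
  have "(dft_mat L *\<^sub>v cyclic_shift L (s \<omega>) (x \<omega>)) $ k *
      cnj ((dft_mat L *\<^sub>v cyclic_shift L (s \<omega>) (x \<omega>)) $ k) =
      (dft_mat L *\<^sub>v x \<omega>) $ k * cnj ((dft_mat L *\<^sub>v x \<omega>) $ k)" for \<omega>
  proof -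
    have "root_char L t * cnj (root_char L t) = 1" for t
      by (simp add: root_char_def cis_cnj cis_mult)
    then show ?thesis
      using assms by (simp add: dft_cyclic_shift del: index_mult_mat_vec)
  qed
  then show ?thesis
    by (simp add: power_spectrum_def del: index_mult_mat_vec)
qed

lemma trispectrum_cyclic_shift:
  assumes "\<And>\<omega>. dim_vec (x \<omega>) = L" and "k1 < L" and "k2 < L" and "k3 < L"
  shows "trispectrum M L (\<lambda>\<omega>. cyclic_shift L (s \<omega>) (x \<omega>)) k1 k2 k3 = trispectrum M L x k1 k2 k3"
proof -
  let ?k4 = "cyc L (int k1 - int k2 + int k3)"
  have L: "L > 0" "?k4 < L"
    using assms(2) by (auto intro: cyc_less)
  \<comment> \<open>Collects the four shift phases in front, where
    \<open>root_char_phase_cancel\<close> applies.\<close>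
  have "A * a * cnj (B * b) * (C * c) * cnj (D * d) =
      (A * cnj B * C * cnj D) * (a * cnj b * c * cnj d)" for A B C D a b c d :: complex
    by (simp add: mult_ac)
  then show ?thesis
    unfolding trispectrum_def using assms L
    by (simp only: dft_cyclic_shift root_char_phase_cancel mult_1_left)
qed

section \<open>Solution set of the algebraic equations\<close>

text \<open>In each summand of \<open>T_map\<close> the two entries lie on the same circulant
  diagonal and one is conjugated, so unimodular weights constant along diagonals cancel. Conversely,
  the quotients of \<open>X\<close> by \<open>S\<close> turn out to be such weights.\<close>

lemma T_map_P_map_eq_iff:
  assumes L: "L > 0"
    and S: "S \<in> carrier_mat L L" and X: "X \<in> carrier_mat L L"
    and nz: "\<And>i j. i < L \<Longrightarrow> j < L \<Longrightarrow> S $$ (i, j) \<noteq> 0"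
  shows "((\<forall>k<L. P_map S k = P_map X k) \<and>
          (\<forall>k1<L. \<forall>k2<L. \<forall>k3<L. T_map L S k1 k2 k3 = T_map L X k1 k2 k3))
     \<longleftrightarrow> (\<exists>z \<in> carrier_vec L. z $ 0 = 1 \<and> (\<forall>k<L. cmod (z $ k) = 1) \<and> X = hadamard S (circulant z))"
    (is "?eqs \<longleftrightarrow> ?ex")
proof
  assume ?ex
  then obtain z where z: "z \<in> carrier_vec L" "z $ 0 = 1" "\<And>k. k < L \<Longrightarrow> cmod (z $ k) = 1"
    and X_eq: "X = hadamard S (circulant z)"
    by auto
  have idx: "X $$ (i, j) = S $$ (i, j) * z $ cyc L (int j - int i)" if "i < L" "j < L" for i j
    using S z that by (simp add: X_eq hadamard_def circulant_def)
  have "P_map S k = P_map X k" if "k < L" for k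
    using that L z(2) by (simp add: P_map_def idx cyc_def)
  moreover have "T_map L S k1 k2 k3 = T_map L X k1 k2 k3"
    if "k1 < L" "k2 < L" "k3 < L" for k1 k2 k3
  proof -
    have unit: "z $ cyc L t * cnj (z $ cyc L t) = 1" for t
      using z(3)[OF cyc_less[OF L]] by (simp add: complex_norm_square[symmetric])
    have cancel: "S $$ p * z $ cyc L t * cnj (S $$ q * z $ cyc L t) = S $$ p * cnj (S $$ q)" for p q t
      using unit[of t] by (simp add: mult_ac)
    show ?thesis
      using that L by (simp add: T_map_def idx cyc_less cyc_add_cyc cancel del: complex_cnj_mult)
  qed
  ultimately show ?eqs
    by blast
next
  assume eqs: ?eqs
  \<comment> \<open>\<open>d\<close> numbers the circulant diagonal, \<open>k\<close> the
    row.\<close>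
  define q where "q d k = X $$ (k, cyc L (int k + int d)) / S $$ (k, cyc L (int k + int d))" for d k
  have X_q: "X $$ (k, cyc L (int k + int d)) = q d k * S $$ (k, cyc L (int k + int d))" if "k < L" for k d
    using that nz cyc_less[OF L] by (simp add: q_def)
  have diag: "X $$ (k, k) = S $$ (k, k)" if "k < L" for k
    using eqs that by (simp add: P_map_def)
  have q0: "q 0 k = 1" if "k < L" for k
    using that nz by (simp add: q_def cyc_of_nat diag)
  let ?w = "\<lambda>d k. S $$ (k, cyc L (int k + int d))"
  txt \<open>The trispectrum equation at \<open>k1 = k\<close>, \<open>k2 = k + d\<close>, \<open>k3 = k + d + e\<close>.\<close>
  have main: "?w d k * cnj (?w d (cyc L (int k + int e))) +
        ?w e k * cnj (?w e (cyc L (int k + int d))) =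
      q d k * cnj (q d (cyc L (int k + int e))) * (?w d k * cnj (?w d (cyc L (int k + int e)))) +
      q e k * cnj (q e (cyc L (int k + int d))) * (?w e k * cnj (?w e (cyc L (int k + int d))))"
    if "k < L" for d e k
  proof -
    have c1: "cyc L (int (cyc L (int k + int d + int e)) - int (cyc L (int k + int d)) + int k) =
        cyc L (int k + int e)"
      using L by (simp add: int_cyc, simp add: cyc_def mod_simps algebra_simps)
    \<comment> \<open>Column \<open>k + d + e\<close> lies on diagonal \<open>d\<close> seen from
      row \<open>k + e\<close> and on diagonal \<open>e\<close> seen from row \<open>k + d\<close>;
      in this form \<open>X_q\<close> rewrites all four entries of \<open>X\<close>.\<close>
    have c2: "cyc L (int (cyc L (int k + int e)) + int d) = cyc L (int k + int d + int e)"
      "cyc L (int (cyc L (int k + int d)) + int e) = cyc L (int k + int d + int e)"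
      using L by (simp_all add: cyc_add_cyc algebra_simps)
    have "T_map L S k (cyc L (int k + int d)) (cyc L (int k + int d + int e)) =
        T_map L X k (cyc L (int k + int d)) (cyc L (int k + int d + int e))"
      using eqs that cyc_less[OF L] by blast
    then have "?w d k * cnj (S $$ (cyc L (int k + int e), cyc L (int (cyc L (int k + int e)) + int d))) +
        ?w e k * cnj (S $$ (cyc L (int k + int d), cyc L (int (cyc L (int k + int d)) + int e))) =
        X $$ (k, cyc L (int k + int d)) *
          cnj (X $$ (cyc L (int k + int e), cyc L (int (cyc L (int k + int e)) + int d))) +
        X $$ (k, cyc L (int k + int e)) *
          cnj (X $$ (cyc L (int k + int d), cyc L (int (cyc L (int k + int d)) + int e)))"
      unfolding T_map_def c1 c2 .
    then show ?thesis
      using that cyc_less[OF L] by (simp only: X_q complex_cnj_mult) (simp add: mult_ac)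
  qed
  \<comment> \<open>For \<open>e = 0\<close> the second summand carries only \<open>q 0 = 1\<close>
    and cancels; the first is a nonzero number times the left side.\<close>
  have unit: "q d k * cnj (q d k) = 1" if "k < L" for d k
    using main[OF that, of d 0] that L nz cyc_less[OF L] by (simp add: cyc_of_nat q0)
  \<comment> \<open>The conjugate of a unimodular number is its inverse.\<close>
  have eqI: "q d k = q d' k'" if "q d k * cnj (q d' k') = 1" "k' < L" for d d' k k'
    using unit[OF that(2), of d'] that(1) by (metis mult.commute mult_cancel_left mult_zero_right zero_neq_one)
  \<comment> \<open>For \<open>d = e = 1\<close> the two summands coincide, so their nonzero factor
    can be cancelled.\<close>
  have q1: "q 1 k = q 1 (cyc L (int k + 1))" if "k < L" for k
    using main[OF that, of 1 1] that nz cyc_less[OF L]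
    by (intro eqI) (auto simp flip: distrib_right distrib_left mult_2)
  \<comment> \<open>The induction stays below \<open>L\<close>, so \<open>cyc\<close> never wraps
    around.\<close>
  have q1_const: "q 1 k = q 1 0" if "k < L" for k
    using that
  proof (induction k)
    case (Suc k)
    then show ?case
      using q1[of k] cyc_of_nat[of "Suc k" L] by (simp add: add.commute)
  qed simp
  have qd: "q d k = q d (cyc L (int k + 1))" if "k < L" for d k
  proof (rule eqI)
    \<comment> \<open>This is the coefficient of the second summand in \<open>main\<close> with
      \<open>e = 1\<close>; being 1, it lets that summand cancel.\<close>
    have "q 1 k * cnj (q 1 (cyc L (int k + int d))) = 1"
      using unit[OF that, of 1] q1_const[OF that] q1_const[OF cyc_less[OF L]] by metis
    then show "q d k * cnj (q d (cyc L (int k + 1))) = 1"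
      using main[OF that, of d 1] that nz cyc_less[OF L] by simp
  qed (rule cyc_less[OF L])
  have q_const: "q d k = q d 0" if "k < L" for d k
    using that
  proof (induction k)
    case (Suc k)
    then show ?case
      using qd[of k d] cyc_of_nat[of "Suc k" L] by (simp add: add.commute)
  qed simp
  show ?ex
  proof (intro bexI conjI allI impI)
    \<comment> \<open>The witness takes the quotient in row 0 of each diagonal, which by
      \<open>q_const\<close> stands for the whole diagonal.\<close>
    show "vec L (\<lambda>d. q d 0) $ 0 = 1"
      using L q0 by simp
    show "cmod (vec L (\<lambda>d. q d 0) $ k) = 1" if "k < L" for k
    proof -
      have "(cmod (q k 0))\<^sup>2 = 1"
        using arg_cong[OF unit[OF L], of cmod] by (simp add: norm_mult power2_eq_square)
      then show ?thesis
        using that by (simp add: abs_square_eq_1)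
    qed
    show "X = hadamard S (circulant (vec L (\<lambda>d. q d 0)))"
    proof (rule eq_matI)
      fix i j
      assume "i < dim_row (hadamard S (circulant (vec L (\<lambda>d. q d 0))))"
        and "j < dim_col (hadamard S (circulant (vec L (\<lambda>d. q d 0))))"
      then have ij: "i < L" "j < L"
        using S by (auto simp: hadamard_def)
      \<comment> \<open>Entry \<open>(i, j)\<close> lies on diagonal \<open>j - i\<close> modulo
        \<open>L\<close>.\<close>
      have "cyc L (int i + int (cyc L (int j - int i))) = j"
        using L ij by (simp add: cyc_add_cyc cyc_of_nat)
      then show "X $$ (i, j) = hadamard S (circulant (vec L (\<lambda>d. q d 0))) $$ (i, j)"
        using X_q[OF ij(1), of "cyc L (int j - int i)"] q_const[OF ij(1)] S ij cyc_less[OF L]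
        by (simp add: hadamard_def circulant_def)
    qed (use S X in \<open>auto simp: hadamard_def\<close>)
  qed simp
qed

section \<open>The spectra of the model and the phases of the solutions\<close>

theorem lemma2:
  fixes M :: "'w measure"
    and L r :: nat
    and v :: "nat \<Rightarrow> complex vec"
    and lam :: "nat \<Rightarrow> real"
    and a :: "nat \<Rightarrow> 'w \<Rightarrow> complex"
    and s :: "'w \<Rightarrow> nat"
    and x y :: "'w \<Rightarrow> complex vec"
    and \<Sigma> X :: "complex mat"
  assumes "prob_space M"
    and "L > 0"
    and "orthonormal_family L {1..r} v"
    and "\<And>i. i \<in> {1..r} \<Longrightarrow> lam i > 0"
    and "\<And>i. i \<in> {1..r} \<Longrightarrow> complex_normal M (lam i) (a i)"
    and "prob_space.indep_vars M (\<lambda>_. borel) a {1..r}"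
    and x: "\<And>\<omega>. x \<omega> = finsum_vec TYPE(complex) L (\<lambda>i. a i \<omega> \<cdot>\<^sub>v v i) {1..r}"
    and "indep_rv M (count_space {..<L}) s (vec_borel L) (\<lambda>\<omega>. vec_fun L (x \<omega>))"
    and y: "\<And>\<omega>. y \<omega> = cyclic_shift L (s \<omega>) (x \<omega>)"
    and \<Sigma>: "\<Sigma> = second_moment M L (\<lambda>\<omega>. dft_mat L *\<^sub>v x \<omega>)"
    and "\<And>i j. i < L \<Longrightarrow> j < L \<Longrightarrow> \<Sigma> $$ (i, j) \<noteq> 0"
    and "X \<in> carrier_mat L L"
  shows "((\<forall>k<L. power_spectrum M L y k = P_map X k) \<and>
          (\<forall>k1<L. \<forall>k2<L. \<forall>k3<L. trispectrum M L y k1 k2 k3 = T_map L X k1 k2 k3))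
     \<longleftrightarrow> (\<exists>\<phi> :: nat \<Rightarrow> real. (\<forall>k\<in>{1..<L}. \<phi> k \<in> {0..<2 * pi}) \<and>
           X = hadamard \<Sigma> (circulant (vec L (\<lambda>k. if k = 0 then 1 else exp (\<i> * complex_of_real (\<phi> k))))))"
proof -
  let ?b = "\<lambda>i k. (dft_mat L *\<^sub>v v i) $ k"
  let ?x = "\<lambda>\<omega>. dft_mat L *\<^sub>v x \<omega>"
  note moment2 = complex_normal_combination_moment2[OF assms(1) _ assms(4-6)]
  note moment4 = complex_normal_combination_moment4[OF assms(1) _ assms(4-6)]
  have v: "v i \<in> carrier_vec L" if "i \<in> {1..r}" for i
    using assms(3) that by (simp add: orthonormal_family_def)
  have x_carrier: "x \<omega> \<in> carrier_vec L" for \<omega>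
    unfolding x using v by (intro finsum_vec_closed) auto
  then have x_dim: "dim_vec (x \<omega>) = L" for \<omega>
    by simp
  have x_idx: "x \<omega> $ l = (\<Sum>i\<in>{1..r}. a i \<omega> * v i $ l)" if "l < L" for l \<omega>
    unfolding x using v that
    by (subst index_finsum_vec) (auto intro!: sum.cong simp: index_smult_vec(1) carrier_vecD[OF v])
  \<comment> \<open>By linearity the DFT coordinates are again combinations of the
    \<open>a i\<close>, the form that \<open>moment2\<close> and \<open>moment4\<close>
    require.\<close>
  have dft_x: "?x \<omega> $ k = (\<Sum>i\<in>{1..r}. a i \<omega> * ?b i k)" if "k < L" for k \<omega>
  proof -
    have "?x \<omega> $ k = (\<Sum>l<L. \<Sum>i\<in>{1..r}. a i \<omega> *
        (root_char L (int k * int l) / complex_of_real (sqrt (real L)) * v i $ l))"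
      using that x_dim by (simp add: dft_mat_mult_vec x_idx sum_distrib_left mult_ac)
    also have "\<dots> = (\<Sum>i\<in>{1..r}. a i \<omega> * ?b i k)"
      using that v by (subst sum.swap) (simp add: dft_mat_mult_vec sum_distrib_left carrier_vecD)
    finally show ?thesis .
  qed
  have \<Sigma>_carrier: "\<Sigma> \<in> carrier_mat L L"
    by (simp add: \<Sigma> second_moment_def)
  have \<Sigma>_idx: "\<Sigma> $$ (k, l) = (\<Sum>i\<in>{1..r}. complex_of_real (lam i) * ?b i k * cnj (?b i l))"
    if "k < L" "l < L" for k l
  proof -
    have "\<Sigma> $$ (k, l) = (LINT \<omega>|M. ?x \<omega> $ k * cnj (?x \<omega> $ l))"
      using that by (simp add: \<Sigma> second_moment_def del: index_mult_mat_vec)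
    also have "\<dots> = (\<Sum>i\<in>{1..r}. complex_of_real (lam i) * ?b i k * cnj (?b i l))"
      unfolding dft_x[OF that(1)] dft_x[OF that(2)]
      by (rule has_bochner_integral_integral_eq[OF moment2]) auto
    finally show ?thesis .
  qed
  \<comment> \<open>Hermitian symmetry converts the products from Isserlis' formula into the
    conjugates occurring in \<open>T_map\<close>.\<close>
  have \<Sigma>_cnj: "cnj (\<Sigma> $$ (k, l)) = \<Sigma> $$ (l, k)" if "k < L" "l < L" for k l
    using that by (simp add: \<Sigma>_idx mult_ac del: index_mult_mat_vec)
  have y_eq: "y = (\<lambda>\<omega>. cyclic_shift L (s \<omega>) (x \<omega>))"
    using y by blast
  have power: "power_spectrum M L y k = P_map \<Sigma> k" if "k < L" for k
  proof -
    have "power_spectrum M L y k = power_spectrum M L x k"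
      unfolding y_eq by (intro power_spectrum_cyclic_shift x_dim that)
    then show ?thesis
      using that by (simp add: power_spectrum_def P_map_def \<Sigma> second_moment_def del: index_mult_mat_vec)
  qed
  have tri: "trispectrum M L y k1 k2 k3 = T_map L \<Sigma> k1 k2 k3"
    if k: "k1 < L" "k2 < L" "k3 < L" for k1 k2 k3
  proof -
    \<comment> \<open>\<open>trispectrum\<close> and \<open>T_map\<close> write this index with the
      summands in different orders.\<close>
    define k4 where "k4 = cyc L (int k1 - int k2 + int k3)"
    have k4: "k4 < L" "cyc L (int k3 - int k2 + int k1) = k4"
      using cyc_less[OF \<open>L > 0\<close>] by (simp_all add: k4_def algebra_simps)
    have "trispectrum M L y k1 k2 k3 = trispectrum M L x k1 k2 k3"
      unfolding y_eq by (intro trispectrum_cyclic_shift x_dim k)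
    also have "\<dots> = \<Sigma> $$ (k1, k2) * \<Sigma> $$ (k3, k4) + \<Sigma> $$ (k1, k4) * \<Sigma> $$ (k3, k2)"
      unfolding trispectrum_def k4_def[symmetric] dft_x[OF k(1)] dft_x[OF k(2)] dft_x[OF k(3)]
        dft_x[OF k4(1)] \<Sigma>_idx[OF k(1,2)] \<Sigma>_idx[OF k(3) k4(1)] \<Sigma>_idx[OF k(1) k4(1)]
        \<Sigma>_idx[OF k(3,2)]
      by (rule has_bochner_integral_integral_eq[OF moment4]) auto
    finally show ?thesis
      using k k4 by (simp add: T_map_def \<Sigma>_cnj)
  qed
  \<comment> \<open>Stated for arbitrary \<open>Q\<close>, to be instantiated with the equation for
    \<open>X\<close>. The phases come from \<open>Arg2pi\<close>, whose values lie in the required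
    half-open interval.\<close>
  have unimodular_iff: "(\<exists>z \<in> carrier_vec L. z $ 0 = 1 \<and> (\<forall>k<L. cmod (z $ k) = 1) \<and> Q z) \<longleftrightarrow>
      (\<exists>\<phi> :: nat \<Rightarrow> real. (\<forall>k\<in>{1..<L}. \<phi> k \<in> {0..<2 * pi}) \<and>
        Q (vec L (\<lambda>k. if k = 0 then 1 else exp (\<i> * complex_of_real (\<phi> k)))))" for Q
  proof
    assume "\<exists>z \<in> carrier_vec L. z $ 0 = 1 \<and> (\<forall>k<L. cmod (z $ k) = 1) \<and> Q z"
    then obtain z where z: "z \<in> carrier_vec L" "z $ 0 = 1" "\<And>k. k < L \<Longrightarrow> cmod (z $ k) = 1" "Q z"
      by auto
    have "z = vec L (\<lambda>k. if k = 0 then 1 else exp (\<i> * complex_of_real (Arg2pi (z $ k))))"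
      using z(1-3) by (intro eq_vecI) (auto simp: complex_norm_eq_1_exp)
    with z(4) show "\<exists>\<phi> :: nat \<Rightarrow> real. (\<forall>k\<in>{1..<L}. \<phi> k \<in> {0..<2 * pi}) \<and>
        Q (vec L (\<lambda>k. if k = 0 then 1 else exp (\<i> * complex_of_real (\<phi> k))))"
      by (intro exI[of _ "\<lambda>k. Arg2pi (z $ k)"]) (auto simp: Arg2pi_ge_0 Arg2pi_lt_2pi)
  next
    assume "\<exists>\<phi> :: nat \<Rightarrow> real. (\<forall>k\<in>{1..<L}. \<phi> k \<in> {0..<2 * pi}) \<and>
        Q (vec L (\<lambda>k. if k = 0 then 1 else exp (\<i> * complex_of_real (\<phi> k))))"
    then obtain \<phi> :: "nat \<Rightarrow> real"
      where "Q (vec L (\<lambda>k. if k = 0 then 1 else exp (\<i> * complex_of_real (\<phi> k))))"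
      by blast
    then show "\<exists>z \<in> carrier_vec L. z $ 0 = 1 \<and> (\<forall>k<L. cmod (z $ k) = 1) \<and> Q z"
      using \<open>L > 0\<close> by (intro bexI conjI) auto
  qed
  show ?thesis
    using T_map_P_map_eq_iff[OF \<open>L > 0\<close> \<Sigma>_carrier assms(12,11)]
      unimodular_iff[of "\<lambda>z. X = hadamard \<Sigma> (circulant z)"]
    by (simp add: power tri)
qed

end
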